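(* Let $G$ be any connected chordal graph, let $\mathcal T$ be the set of clique trees of $G$, let $\varPi$ be the set of perfect sequences of the maximal cliques of $G$, and let $\mathcal R\subseteq\mathcal T\times\varPi$ be the relation "$T$ can be generated from $\pi$" defined in the context. Then the bipartite graph $B=(\mathcal T\cup\varPi,\mathcal R)$, with vertex classes $\mathcal T$ and $\varPi$ and an edge between $T$ and $\pi$ exactly when $(T,\pi)\in\mathcal R$, is connected.
   Context: Graphs are finite, simple and undirected. Maximal cliques are regarded as subsets of the vertex set; $\mathcal C=\{C_1,\dots,C_K\}$ is the set of all maximal cliques of $G$. A clique tree of $G$ is a tree $T=(\mathcal C,\mathcal E)$ with node set $\mathcal C$ such that for all $C_1,C_2\in\mathcal C$ and every $C_3\in\mathcal C$ on the unique path in $T$ between $C_1$ and $C_2$, $C_1\cap C_2\subseteq C_3$. For a permutation $\pi$ of $\{1,\dots,K\}$ put $S_{\pi(k)}=(C_{\pi(1)}\cup\cdots\cup C_{\pi(k-1)})\cap C_{\pi(k)}$ for $k=2,\dots,K$. The sequence $C_{\pi(1)},\dots,C_{\pi(K)}$ (identified with $\pi$) is a perfect sequence if for all $k\ge2$ the set $S_{\pi(k)}$ is a clique and there exists $k'<k$ with $S_{\pi(k)}\subset C_{\pi(k')}$. Given $\pi\in\varPi$, a tree with node set $\mathcal C$ is generated from $\pi$ as follows: start with no edges; for each $k=2,\dots,K$ choose any $k'<k$ with $S_{\pi(k)}=C_{\pi(k')}\cap C_{\pi(k)}$ and add the edge $(C_{\pi(k)},C_{\pi(k')})$. Every tree obtained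 this way is a clique tree. Define $(T,\pi)\in\mathcal R$ if $T$ can be generated from $\pi$ by this procedure for some sequence of choices. *)

theory Defs
  imports "Graph_Theory.Pair_Digraph" "Graph_Theory.Digraph_Component"
begin

text \<open>
  A finite simple undirected graph is a \<^locale>\<open>pair_graph\<close>, i.e. a finite loop-free symmetric
  digraph whose arcs are pairs of vertices.  In this encoding the walk u, v, u along one undirected
  edge is a \<^const>\<open>pre_digraph.cycle\<close> of length 2.  Genuine undirected cycles are exactly
  the cycles of length at least 3, and the constant \<^const>\<open>tree\<close>, which forbids 2-cycles as
  well, is not the notion of tree needed here.
\<close>

definition undirected_cycle :: "'a pair_pre_digraph \<Rightarrow> ('a \<times> 'a) awalk \<Rightarrow> bool" where
  "undirected_cycle G p \<longleftrightarrow> pre_digraph.cycle (with_proj G) p \<and> 3 \<le> length p"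

definition undirected_tree :: "'a pair_pre_digraph \<Rightarrow> bool" where
  "undirected_tree T \<longleftrightarrow>
     pair_graph T \<and> connected (with_proj T) \<and> (\<nexists>p. undirected_cycle T p)"

text \<open>
  Every cycle on at least four vertices has a chord: an edge of the graph that joins two vertices
  of the cycle but is not an edge of the cycle.
\<close>

definition chordal :: "'a pair_pre_digraph \<Rightarrow> bool" where
  "chordal G \<longleftrightarrow> (\<forall>p. undirected_cycle G p \<and> 4 \<le> length p \<longrightarrow>
     (\<exists>u \<in> fst ` set p. \<exists>v \<in> fst ` set p.
        (u, v) \<in> parcs G \<and> (u, v) \<notin> set p \<and> (v, u) \<notin> set p))"

definition clique :: "'a pair_pre_digraph \<Rightarrow> 'a set \<Rightarrow> bool" where
  "clique G C \<longleftrightarrow> C \<subseteq> pverts G \<and> (\<forall>u \<in> C. \<forall>v \<in> C. u \<noteq> v \<longrightarrow> (u, v) \<in> parcs G)"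

definition maximal_cliques :: "'a pair_pre_digraph \<Rightarrow> 'a set set" where
  "maximal_cliques G = {C. clique G C \<and> (\<forall>D. clique G D \<and> C \<subseteq> D \<longrightarrow> D = C)}"

text \<open>
  In a tree there is exactly one path between two given nodes, so that quantifying over all paths
  is the same as speaking of the unique one.
\<close>

definition clique_trees :: "'a pair_pre_digraph \<Rightarrow> 'a set pair_pre_digraph set" where
  "clique_trees G = {T. undirected_tree T \<and> pverts T = maximal_cliques G \<and>
     (\<forall>C1 C2 p. pre_digraph.apath (with_proj T) C1 p C2 \<longrightarrow>
        (\<forall>C3 \<in> set (pawalk_verts C1 p). C1 \<inter> C2 \<subseteq> C3))}"

text \<open>
  A permutation of the maximal cliques is given as the list Cs of the cliques in the permuted order.
  Lists are indexed from 0, so Cs ! k is the (k+1)-st clique of the sequence, and the index range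
  k = 2, ..., K becomes k = 1, ..., K - 1.
\<close>

definition separator :: "'a set list \<Rightarrow> nat \<Rightarrow> 'a set" where
  "separator Cs k = (\<Union>i<k. Cs ! i) \<inter> Cs ! k"

definition perfect_sequences :: "'a pair_pre_digraph \<Rightarrow> 'a set list set" where
  "perfect_sequences G = {Cs. distinct Cs \<and> set Cs = maximal_cliques G \<and>
     (\<forall>k \<in> {1..<length Cs}. clique G (separator Cs k) \<and> (\<exists>k'<k. separator Cs k \<subseteq> Cs ! k'))}"

text \<open>The function f records the choice of k' made at each step k.\<close>

definition generated_from :: "'a set pair_pre_digraph \<Rightarrow> 'a set list \<Rightarrow> bool" where
  "generated_from T Cs \<longleftrightarrow> (\<exists>f :: nat \<Rightarrow> nat.
     (\<forall>k \<in> {1..<length Cs}. f k < k \<and> separator Cs k = Cs ! f k \<inter> Cs ! k) \<and>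
     T = \<lparr> pverts = set Cs,
           parcs = (\<Union>k \<in> {1..<length Cs}. {(Cs ! k, Cs ! f k), (Cs ! f k, Cs ! k)}) \<rparr>)"

definition generation_rel ::
  "'a pair_pre_digraph \<Rightarrow> ('a set pair_pre_digraph \<times> 'a set list) set" where
  "generation_rel G =
     {(T, Cs). T \<in> clique_trees G \<and> Cs \<in> perfect_sequences G \<and> generated_from T Cs}"

definition bipartite_graph ::
  "'a set \<Rightarrow> 'b set \<Rightarrow> ('a \<times> 'b) set \<Rightarrow> ('a + 'b) pair_pre_digraph" where
  "bipartite_graph A B R =
     \<lparr> pverts = Inl ` A \<union> Inr ` B,
       parcs = (\<Union>(a, b) \<in> R. {(Inl a, Inr b), (Inr b, Inl a)}) \<rparr>"

end

theory Submission
  imports Defs "Graph_Theory.Vertex_Walk"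
begin

text \<open>
  A clique tree can be rebuilt by adding one leaf at a time, starting from any root, so every tree is
  adjacent to a perfect sequence and it suffices to link two perfect sequences of the same family
  through shared trees.  This goes by induction on the number of cliques.  Let the first sequence end
  with L, attached to P.  Re-root a tree of the second sequence at P, so that L comes after P there.
  As P absorbs every intersection of L with another clique, whatever hangs on L can be attached to P
  instead; L is then a leaf and may be moved to the end, and both sequences continue without L.
  A perfect sequence exists because a chordal graph has a simplicial vertex.
\<close>

section \<open>Running intersection orders\<close>

text \<open>The relation E collects the arcs, in both directions, of the tree that is generated along the
  list.\<close>

inductive rip :: "'a set rel \<Rightarrow> 'a set list \<Rightarrow> bool" where
  single: "rip {} [C]"
| snoc: "rip E Cs \<Longrightarrow> L \<notin> set Cs \<Longrightarrow> P \<in> set Cs \<Longrightarrow> \<Union>(set Cs) \<inter> L \<subseteq> P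
    \<Longrightarrow> rip (E \<union> {(L, P), (P, L)}) (Cs @ [L])"

lemma rip_nonempty: "rip E Cs \<Longrightarrow> Cs \<noteq> []"
  by (induction rule: rip.induct) auto

lemma rip_distinct: "rip E Cs \<Longrightarrow> distinct Cs"
  by (induction rule: rip.induct) auto

lemma rip_subset: "rip E Cs \<Longrightarrow> E \<subseteq> set Cs \<times> set Cs"
  by (induction rule: rip.induct) auto

lemma rip_sym: "rip E Cs \<Longrightarrow> sym E"
  by (induction rule: rip.induct) (auto simp: sym_def)

lemma rip_irrefl: "rip E Cs \<Longrightarrow> (x, x) \<notin> E"
  by (induction rule: rip.induct) auto

lemma rip_snocE:
  assumes "rip E (Cs @ [L])" "Cs \<noteq> []"
  obtains E0 P where "rip E0 Cs" "L \<notin> set Cs" "P \<in> set Cs" "\<Union>(set Cs) \<inter> L \<subseteq> P"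
    "E = E0 \<union> {(L, P), (P, L)}"
  using assms(1) by (cases rule: rip.cases) (use assms(2) in auto)

text \<open>The newest set \<open>L\<close> hangs on \<open>P\<close> by one edge, so a path of the
  old tree with an end at \<open>P\<close> extends to \<open>L\<close>. Paths are vertex lists
  throughout, and \<open>vwalk_arcs\<close> lists their consecutive pairs.\<close>

lemma rip_path:
  assumes "rip E Cs" "u \<in> set Cs" "v \<in> set Cs"
  shows "\<exists>xs. xs \<noteq> [] \<and> distinct xs \<and> hd xs = u \<and> last xs = v \<and> set xs \<subseteq> set Cs
    \<and> set (vwalk_arcs xs) \<subseteq> E"
  using assms
proof (induction arbitrary: u v rule: rip.induct)
  case (single C)
  then show ?case by (intro exI[of _ "[C]"]) auto
next
  case (snoc E Cs L P)
  consider "u \<in> set Cs" "v \<in> set Cs" | "u = L" "v = L" | "u = L" "v \<in> set Cs" | "u \<in> set Cs" "v = L"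
    using snoc.prems by auto
  then show ?case
  proof cases
    case 1
    from snoc.IH[OF this] show ?thesis by fastforce
  next
    case 2
    then show ?thesis by (intro exI[of _ "[L]"]) auto
  next
    case 3
    from snoc.IH[OF \<open>P \<in> set Cs\<close> 3(2)] obtain xs where
      "xs \<noteq> []" "distinct xs" "hd xs = P" "last xs = v" "set xs \<subseteq> set Cs" "set (vwalk_arcs xs) \<subseteq> E"
      by blast
    with 3 \<open>L \<notin> set Cs\<close> show ?thesis by (intro exI[of _ "L # xs"]) auto
  next
    case 4
    from snoc.IH[OF 4(1) \<open>P \<in> set Cs\<close>] obtain xs where
      "xs \<noteq> []" "distinct xs" "hd xs = u" "last xs = P" "set xs \<subseteq> set Cs" "set (vwalk_arcs xs) \<subseteq> E"
      by blast
    with 4 \<open>L \<notin> set Cs\<close> show ?thesis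
      by (intro exI[of _ "xs @ [L]"]) (auto simp: vwalk_arcs_append)
  qed
qed

lemma vwalk_arcs_in_set: "(a, b) \<in> set (vwalk_arcs xs) \<Longrightarrow> a \<in> set xs \<and> b \<in> set xs"
  by (induction xs rule: vwalk_arcs.induct) auto

text \<open>This is the clique tree property of the generated tree. The newest set is a leaf, so it
  can only be an end of a path; its intersection with the other end lies in its neighbour
  \<open>P\<close>, and induction applies to the path that ends at \<open>P\<close>.\<close>

lemma rip_junction:
  assumes "rip E Cs" "xs \<noteq> []" "distinct xs" "set xs \<subseteq> set Cs" "set (vwalk_arcs xs) \<subseteq> E" "C \<in> set xs"
  shows "hd xs \<inter> last xs \<subseteq> C"
  using assms
proof (induction arbitrary: xs C rule: rip.induct)
  case (single D)
  then show ?case by (cases xs) auto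
next
  case (snoc E Cs L P)
  have leaf: "x = P" if "(x, L) \<in> E \<union> {(L, P), (P, L)} \<or> (L, x) \<in> E \<union> {(L, P), (P, L)}" for x
    using that rip_subset[OF snoc.hyps(1)] snoc.hyps(2,3) by auto
  have old: "set (vwalk_arcs ys) \<subseteq> E"
    if "set (vwalk_arcs ys) \<subseteq> E \<union> {(L, P), (P, L)}" "L \<notin> set ys" for ys
    using that vwalk_arcs_in_set[of _ _ ys] by fastforce
  show ?case
  proof (cases "L \<in> set xs")
    case False
    then show ?thesis
      using snoc.IH[of xs C] snoc.prems old[of xs] by auto
  next
    case True
    then obtain a b where ab: "xs = a @ L # b" by (meson split_list)
    then have L: "L \<notin> set a" "L \<notin> set b" using snoc.prems by auto
    have a: "last a = P \<and> set (vwalk_arcs a) \<subseteq> E" if "a \<noteq> []"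
    proof -
      have arcs: "set (vwalk_arcs a) \<union> {(last a, L)} \<subseteq> E \<union> {(L, P), (P, L)}"
        using snoc.prems(4) that unfolding ab by (simp add: vwalk_arcs_append)
      then have "last a = P" by (intro leaf) blast
      then show ?thesis using old[of a] arcs L by blast
    qed
    have Lb: "set (vwalk_arcs (L # b)) \<subseteq> E \<union> {(L, P), (P, L)}"
      using snoc.prems(4) unfolding ab by (cases "a = []") (auto simp: vwalk_arcs_append)
    have b: "hd b = P \<and> set (vwalk_arcs b) \<subseteq> E" if "b \<noteq> []"
    proof -
      have arcs: "set (vwalk_arcs b) \<union> {(L, hd b)} \<subseteq> E \<union> {(L, P), (P, L)}"
        using Lb that by simp
      then have "hd b = P" by (intro leaf) blast
      then show ?thesis using old[of b] arcs L by blast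
    qed
    \<comment> \<open>Inside the path, \<open>L\<close> would have \<open>P\<close> on both sides,
      against distinctness.\<close>
    have "\<not> (a \<noteq> [] \<and> b \<noteq> [])"
    proof
      assume "a \<noteq> [] \<and> b \<noteq> []"
      then have "P \<in> set a" "P \<in> set b" using a b by (metis last_in_set, metis hd_in_set)
      then show False using snoc.prems(2) unfolding ab by auto
    qed
    then consider "a = []" "b = []" | "a = []" "b \<noteq> []" | "a \<noteq> []" "b = []" by blast
    then show ?thesis
    proof cases
      case 1
      then show ?thesis using snoc.prems(5) ab by auto
    next
      case 2
      have "set b \<subseteq> set Cs" using snoc.prems ab L by auto
      then have "last b \<inter> L \<subseteq> P" using snoc.hyps(4) last_in_set[OF 2(2)] by blast
      moreover have "P \<inter> last b \<subseteq> D" if "D \<in> set b" for D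
        using snoc.IH[of b D] b 2 that \<open>set b \<subseteq> set Cs\<close> snoc.prems(2) ab by auto
      ultimately show ?thesis using snoc.prems(5) 2 ab by auto
    next
      case 3
      have "set a \<subseteq> set Cs" using snoc.prems ab L by auto
      then have "hd a \<inter> L \<subseteq> P" using snoc.hyps(4) hd_in_set[OF 3(1)] by blast
      moreover have "hd a \<inter> P \<subseteq> D" if "D \<in> set a" for D
        using snoc.IH[of a D] a 3 that \<open>set a \<subseteq> set Cs\<close> snoc.prems(2) ab by auto
      ultimately show ?thesis using snoc.prems(5) 3 ab by auto
    qed
  qed
qed

text \<open>A leaf lies on no cycle: both neighbours of \<open>L\<close> on it would be
  \<open>P\<close>, which three distinct vertices exclude. A cycle avoiding \<open>L\<close> lives
  in the old tree.\<close>

lemma rip_acyclic: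
  assumes "rip E Cs" "distinct xs" "3 \<le> length xs" "set (vwalk_arcs (xs @ [hd xs])) \<subseteq> E"
  shows False
  using assms
proof (induction arbitrary: xs rule: rip.induct)
  case (single D)
  then show ?case by (cases xs) auto
next
  case (snoc E Cs L P)
  have leaf: "x = P" if "(x, L) \<in> E \<union> {(L, P), (P, L)} \<or> (L, x) \<in> E \<union> {(L, P), (P, L)}" for x
    using that rip_subset[OF snoc.hyps(1)] snoc.hyps(2,3) by auto
  show ?case
  proof (cases "L \<in> set xs")
    case False
    then have "L \<notin> set (xs @ [hd xs])" using snoc.prems(2) by (cases xs) auto
    then have "set (vwalk_arcs (xs @ [hd xs])) \<subseteq> E"
      using snoc.prems(3) vwalk_arcs_in_set[of _ _ "xs @ [hd xs]"] by fastforce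
    then show ?thesis using snoc.IH snoc.prems by blast
  next
    case True
    then obtain a b where ab: "xs = a @ L # b" by (meson split_list)
    \<comment> \<open>The cycle read from just after \<open>L\<close> round to just before it, so
      that both ends of \<open>ys\<close> are neighbours of \<open>L\<close>.\<close>
    define ys where "ys = b @ a"
    have ys: "distinct ys" "2 \<le> length ys"
      using snoc.prems ab by (auto simp: ys_def)
    then have ne: "ys \<noteq> []" by auto
    have "(L, hd ys) \<in> set (vwalk_arcs (xs @ [hd xs]))"
      using ne unfolding ab ys_def
      by (cases "b = []"; cases "a = []") (auto simp: vwalk_arcs_append)
    moreover have "(last ys, L) \<in> set (vwalk_arcs (xs @ [hd xs]))"
      using ne unfolding ab ys_def
      by (cases "b = []"; cases "a = []") (auto simp: vwalk_arcs_append)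
    ultimately have "hd ys = P" "last ys = P" using snoc.prems(3) leaf by blast+
    then show ?thesis using ys by (cases ys) (auto split: if_splits)
  qed
qed

text \<open>Converse to the preceding lemmas: the tree is grown from \<open>r\<close> by repeatedly
  adding a neighbour of the part already reached. Acyclicity makes the point of attachment unique,
  and the path condition makes it absorb the intersections.\<close>

lemma rip_of_tree:
  fixes E :: "'a set rel"
  assumes fin: "finite V" and sub: "E \<subseteq> V \<times> V" and "sym E" and irr: "\<And>x. (x, x) \<notin> E"
    and conn: "\<And>u v. u \<in> V \<Longrightarrow> v \<in> V \<Longrightarrow> (u, v) \<in> E\<^sup>*"
    and acyc: "\<And>xs. distinct xs \<Longrightarrow> 3 \<le> length xs \<Longrightarrow> \<not> set (vwalk_arcs (xs @ [hd xs])) \<subseteq> E"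
    and junction: "\<And>xs C. xs \<noteq> [] \<Longrightarrow> distinct xs \<Longrightarrow> set xs \<subseteq> V \<Longrightarrow> set (vwalk_arcs xs) \<subseteq> E
      \<Longrightarrow> C \<in> set xs \<Longrightarrow> hd xs \<inter> last xs \<subseteq> C"
    and r: "r \<in> V"
  shows "\<exists>Cs. hd Cs = r \<and> set Cs = V \<and> rip E Cs"
proof -
  \<comment> \<open>Each partial order carries exactly the arcs of \<open>E\<close> induced on its
    members; at full length these are all of \<open>E\<close>.\<close>
  have "\<exists>Cs. length Cs = Suc n \<and> hd Cs = r \<and> set Cs \<subseteq> V \<and> rip (E \<inter> set Cs \<times> set Cs) Cs"
    if "Suc n \<le> card V" for n
    using that
  proof (induction n)
    case 0
    have "rip (E \<inter> set [r] \<times> set [r]) [r]" using irr rip.single[of r] by auto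
    then show ?case using r by (intro exI[of _ "[r]"]) auto
  next
    case (Suc n)
    then obtain Cs where Cs: "length Cs = Suc n" "hd Cs = r" "set Cs \<subseteq> V"
      and rip: "rip (E \<inter> set Cs \<times> set Cs) Cs" by auto
    have ne: "Cs \<noteq> []" using Cs by auto
    have "card (set Cs) < card V" using Suc.prems Cs(1) card_length[of Cs] by linarith
    then obtain v where v: "v \<in> V" "v \<notin> set Cs" using Cs(3) by (metis less_irrefl subsetI subset_antisym)
    \<comment> \<open>Otherwise the part reached would be closed under arcs, and \<open>v\<close>
      could not be reached from \<open>r\<close>.\<close>
    have "\<exists>P\<in>set Cs. \<exists>L. L \<notin> set Cs \<and> (P, L) \<in> E"
    proof (rule ccontr)
      assume closed: "\<not> ?thesis"
      have "x \<in> set Cs" if "(r, x) \<in> E\<^sup>*" for x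
        using that by (induction rule: rtrancl_induct) (use closed ne Cs(2) in auto)
      then show False using conn[OF r v(1)] v(2) by blast
    qed
    then obtain P L where PL: "P \<in> set Cs" "L \<notin> set Cs" "(P, L) \<in> E" by blast
    then have LP: "(L, P) \<in> E" and LV: "L \<in> V" using \<open>sym E\<close> sub by (auto dest: symD)
    have "\<Union>(set Cs) \<inter> L \<subseteq> P"
    proof -
      have "D \<inter> L \<subseteq> P" if D: "D \<in> set Cs" for D
      proof -
        obtain xs where xs: "xs \<noteq> []" "distinct xs" "hd xs = D" "last xs = P" "set xs \<subseteq> set Cs"
          "set (vwalk_arcs xs) \<subseteq> E"
          using rip_path[OF rip D PL(1)] by blast
        \<comment> \<open>The path from \<open>D\<close> to \<open>P\<close>, prolonged to
          \<open>L\<close>, has ends \<open>D\<close> and \<open>L\<close> and passes through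
          \<open>P\<close>.\<close>
        then have "P \<in> set (xs @ [L])" using last_in_set by fastforce
        then have "hd (xs @ [L]) \<inter> last (xs @ [L]) \<subseteq> P"
          using xs PL Cs(3) LV by (intro junction) (auto simp: vwalk_arcs_append)
        then show ?thesis using xs by simp
      qed
      then show ?thesis by blast
    qed
    then have new: "rip (E \<inter> set Cs \<times> set Cs \<union> {(L, P), (P, L)}) (Cs @ [L])"
      using rip PL by (intro rip.snoc) auto
    \<comment> \<open>A second arc from the part to \<open>L\<close> would close a cycle with the
      path from \<open>P\<close> to \<open>D\<close>.\<close>
    have only: "D = P" if D: "D \<in> set Cs" "(D, L) \<in> E" for D
    proof (rule ccontr)
      assume "D \<noteq> P"
      obtain xs where xs: "xs \<noteq> []" "distinct xs" "hd xs = P" "last xs = D" "set xs \<subseteq> set Cs"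
          "set (vwalk_arcs xs) \<subseteq> E"
        using rip_path[OF rip PL(1) D(1)] by blast
      with \<open>D \<noteq> P\<close> have "2 \<le> length xs" by (cases xs; cases "tl xs") auto
      then show False
        using acyc[of "L # xs"] xs PL(2) LP D by (auto simp: vwalk_arcs_append)
    qed
    have "E \<inter> set (Cs @ [L]) \<times> set (Cs @ [L]) = E \<inter> set Cs \<times> set Cs \<union> {(L, P), (P, L)}" (is "?A = ?B")
    proof
      have "(L, D) \<in> E \<Longrightarrow> D \<in> set Cs \<Longrightarrow> D = P" for D
        using only symD[OF \<open>sym E\<close>] by blast
      then show "?A \<subseteq> ?B" using only irr[of L] by auto
      show "?B \<subseteq> ?A" using PL LP by auto
    qed
    then have "rip (E \<inter> set (Cs @ [L]) \<times> set (Cs @ [L])) (Cs @ [L])" using new by metis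
    moreover have "hd (Cs @ [L]) = r" "length (Cs @ [L]) = Suc (Suc n)" "set (Cs @ [L]) \<subseteq> V"
      using Cs LV ne by auto
    ultimately show ?case by blast
  qed
  moreover have "card V > 0" using fin r by (auto simp: card_gt_0_iff)
  ultimately obtain Cs where Cs: "length Cs = card V" "hd Cs = r" "set Cs \<subseteq> V"
    and rip: "rip (E \<inter> set Cs \<times> set Cs) Cs"
    by (metis Suc_pred order_refl)
  have "set Cs = V"
    using Cs rip_distinct[OF rip] fin by (metis card_subset_eq distinct_card)
  then show ?thesis using Cs rip sub by (auto simp: Int_absorb2)
qed

lemma rip_rtrancl:
  assumes "rip E Cs" "u \<in> set Cs" "v \<in> set Cs"
  shows "(u, v) \<in> E\<^sup>*"
proof -
  obtain xs where xs: "xs \<noteq> []" "hd xs = u" "last xs = v" "set (vwalk_arcs xs) \<subseteq> E"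
    using rip_path[OF assms] by blast
  then show ?thesis
  proof (induction xs arbitrary: u)
    case (Cons x xs)
    then show ?case
      by (cases "xs = []") (auto intro: converse_rtrancl_into_rtrancl)
  qed simp
qed

text \<open>The hypotheses of \<open>rip_of_tree\<close> speak of the tree and not of an order, so
  growth may start at any member.\<close>

lemma rip_reroot:
  assumes rip: "rip E Cs" and r: "r \<in> set Cs"
  shows "\<exists>Ds. hd Ds = r \<and> set Ds = set Cs \<and> rip E Ds"
proof (rule rip_of_tree)
  show "\<not> set (vwalk_arcs (xs @ [hd xs])) \<subseteq> E" if "distinct xs" "3 \<le> length xs" for xs
    using rip_acyclic[OF rip that] by blast
qed (simp_all add: r rip_subset[OF rip] rip_sym[OF rip] rip_irrefl[OF rip] rip_junction[OF rip]
    rip_rtrancl[OF rip])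

section \<open>Orders sharing a tree\<close>

text \<open>For orders of the maximal cliques this means a common neighbour in the bipartite graph,
  that is, a walk of two edges.\<close>

definition share :: "'a set list rel" where
  "share = {(Cs, Ds). set Cs = set Ds \<and> (\<exists>E. rip E Cs \<and> rip E Ds)}"

text \<open>An element L with a neighbour P absorbing all its intersections may be moved to the end:
  whatever was attached to L can be attached to P instead.\<close>

lemma rip_remove_absorbed:
  assumes "rip E (a @ L # b)" "P \<in> set a" "\<Union>(set a \<union> set b) \<inter> L \<subseteq> P"
  shows "\<exists>E0. rip E0 (a @ b) \<and> rip (E0 \<union> {(L, P), (P, L)}) (a @ L # b)"
  using assms
proof (induction b arbitrary: E rule: rev_induct)
  case Nil
  then have "a \<noteq> []" by auto
  then obtain E0 where "rip E0 a" "L \<notin> set a"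
    using Nil(1) by (auto elim: rip_snocE)
  then show ?case using rip.snoc[of E0 a L P] Nil by auto
next
  case (snoc x b)
  obtain E1 Q where E1: "rip E1 (a @ L # b)" and x: "x \<notin> set (a @ L # b)"
    and Q: "Q \<in> set (a @ L # b)" "\<Union>(set (a @ L # b)) \<inter> x \<subseteq> Q"
    using rip_snocE[of E "a @ L # b" x] snoc.prems(1) by (metis append_Cons append_assoc append_is_Nil_conv list.distinct(1))
  obtain E0 where E0: "rip E0 (a @ b)" "rip (E0 \<union> {(L, P), (P, L)}) (a @ L # b)"
    using snoc.IH[OF E1] snoc.prems by auto
  \<comment> \<open>If \<open>x\<close> hung on \<open>L\<close>, all earlier sets meet
    \<open>x\<close> inside \<open>L\<close>; since \<open>x\<close> meets \<open>L\<close> inside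
    \<open>P\<close>, the set \<open>P\<close> can take over.\<close>
  define Q' where "Q' = (if Q = L then P else Q)"
  have Q': "Q' \<in> set (a @ b)" "\<Union>(set (a @ L # b)) \<inter> x \<subseteq> Q'"
    using Q snoc.prems(2,3) by (auto simp: Q'_def)
  have "rip (E0 \<union> {(x, Q'), (Q', x)}) ((a @ b) @ [x])"
    using E0(1) x Q' by (intro rip.snoc) auto
  moreover have "rip ((E0 \<union> {(L, P), (P, L)}) \<union> {(x, Q'), (Q', x)}) ((a @ L # b) @ [x])"
    using E0(2) x Q' by (intro rip.snoc) auto
  ultimately show ?case
    by (intro exI[of _ "E0 \<union> {(x, Q'), (Q', x)}"]) (simp add: Un_ac insert_commute)
qed

text \<open>The same leaf is added to the common tree. This lifts chains of orders without
  \<open>L\<close> to chains of orders ending in \<open>L\<close>.\<close>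

lemma share_snoc:
  assumes "(Cs, Ds) \<in> share" "L \<notin> set Cs" "P \<in> set Cs" "\<Union>(set Cs) \<inter> L \<subseteq> P"
  shows "(Cs @ [L], Ds @ [L]) \<in> share"
proof -
  obtain E where "set Cs = set Ds" "rip E Cs" "rip E Ds" using assms(1) by (auto simp: share_def)
  then have "rip (E \<union> {(L, P), (P, L)}) (Cs @ [L])" "rip (E \<union> {(L, P), (P, L)}) (Ds @ [L])"
    using assms by (auto intro!: rip.snoc simp del: Un_insert_right)
  then show ?thesis using \<open>set Cs = set Ds\<close> by (auto simp: share_def)
qed

lemma share_connected:
  assumes "rip E Cs" "rip E' Ds" "set Cs = set Ds"
  shows "(Cs, Ds) \<in> share\<^sup>*"
  using assms
proof (induction arbitrary: E' Ds rule: rip.induct)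
  case (single C)
  then have "Ds = [C]"
    using rip_distinct[OF single(1)] distinct_card[of Ds] by (cases Ds; cases "tl Ds") auto
  then show ?case by simp
next
  case (snoc E Cs L P)
  then have "P \<in> set Ds" by auto
  from rip_reroot[OF snoc.prems(1) this] obtain Ds1
    where Ds1: "hd Ds1 = P" "set Ds1 = set Ds" "rip E' Ds1" by blast
  have "L \<noteq> P" using snoc.hyps by auto
  obtain a b where ab: "Ds1 = a @ L # b" using snoc.prems(2) Ds1(2) split_list[of L Ds1] by auto
  have Pa: "P \<in> set a" using Ds1(1) ab \<open>L \<noteq> P\<close> by (cases a) auto
  have L: "L \<notin> set (a @ b)" using rip_distinct[OF Ds1(3)] ab by auto
  have set_ab: "set (a @ b) = set Cs" using L snoc.hyps(2) snoc.prems(2) Ds1(2) ab by auto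
  then have absorb: "\<Union>(set a \<union> set b) \<inter> L \<subseteq> P" using snoc.hyps(4) by auto
  obtain E0 where E0: "rip E0 (a @ b)" "rip (E0 \<union> {(L, P), (P, L)}) Ds1"
    using rip_remove_absorbed[OF Ds1(3)[unfolded ab] Pa absorb] ab by auto
  \<comment> \<open>The tree that generates \<open>Ds1\<close> also generates the order with
    \<open>L\<close> moved to the end.\<close>
  have "rip (E0 \<union> {(L, P), (P, L)}) ((a @ b) @ [L])"
    using E0(1) L Pa absorb by (intro rip.snoc) auto
  then have 1: "((a @ b) @ [L], Ds1) \<in> share" using E0(2) ab by (auto simp: share_def)
  have 2: "(Ds1, Ds) \<in> share" using Ds1 snoc.prems(1) by (auto simp: share_def)
  have "(Cs, a @ b) \<in> share\<^sup>*" using snoc.IH[OF E0(1)] set_ab by simp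
  \<comment> \<open>The equality of sets is carried along the chain because
    \<open>share_snoc\<close> needs at each link that \<open>L\<close> is new and \<open>P\<close>
    is present.\<close>
  then have "set (a @ b) = set Cs \<and> (Cs @ [L], (a @ b) @ [L]) \<in> share\<^sup>*"
  proof (induction rule: rtrancl_induct)
    case (step y z)
    then have "(y @ [L], z @ [L]) \<in> share" "set z = set y"
      using share_snoc[of y z L P] snoc.hyps by (auto simp: share_def)
    then show ?case using step.IH by (auto intro: rtrancl_into_rtrancl)
  qed (use snoc.hyps in simp)
  then show ?case using 1 2 by (meson rtrancl.rtrancl_into_rtrancl)
qed

section \<open>Perfect sequences and clique trees\<close>

lemma separator_append: "k < length Cs \<Longrightarrow> separator (Cs @ Ds) k = separator Cs k"
  by (auto simp: separator_def nth_append)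

lemma separator_snoc: "separator (Cs @ [L]) (length Cs) = \<Union>(set Cs) \<inter> L"
proof -
  have "(\<Union>i<length Cs. Cs ! i) = \<Union>(set Cs)"
    unfolding set_conv_nth by auto
  then show ?thesis by (simp add: separator_def nth_append)
qed

text \<open>As \<open>P\<close> is itself one of the earlier sets, the inclusion in \<open>P\<close>
  sharpens to the equality of the separator with \<open>P \<inter> L\<close>.\<close>

lemma rip_generated:
  assumes "rip E Cs"
  shows "generated_from \<lparr>pverts = set Cs, parcs = E\<rparr> Cs"
proof -
  have "\<exists>f. (\<forall>k \<in> {1..<length Cs}. f k < k \<and> separator Cs k = Cs ! f k \<inter> Cs ! k) \<and>
     E = (\<Union>k \<in> {1..<length Cs}. {(Cs ! k, Cs ! f k), (Cs ! f k, Cs ! k)})"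
    using assms
  proof (induction rule: rip.induct)
    case (single C)
    show ?case by simp
  next
    case (snoc E Cs L P)
    define n where "n = length Cs"
    have "n \<ge> 1" using rip_nonempty[OF snoc.hyps(1)] by (cases Cs) (auto simp: n_def)
    obtain i where i: "i < n" "Cs ! i = P" using snoc.hyps(3) by (auto simp: in_set_conv_nth n_def)
    obtain f where f: "\<And>k. k \<in> {1..<n} \<Longrightarrow> f k < k \<and> separator Cs k = Cs ! f k \<inter> Cs ! k"
      and E: "E = (\<Union>k \<in> {1..<n}. {(Cs ! k, Cs ! f k), (Cs ! f k, Cs ! k)})"
      using snoc.IH unfolding n_def by blast
    \<comment> \<open>Counting from 0, the new set has index \<open>n\<close>, the old length; its
      choice is a position of \<open>P\<close>.\<close>
    let ?f = "f(n := i)" and ?Cs = "Cs @ [L]"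
    have range: "{1..<length ?Cs} = insert n {1..<n}" using \<open>n \<ge> 1\<close> by (auto simp: n_def)
    have old: "?Cs ! k = Cs ! k" "?Cs ! ?f k = Cs ! f k" if "k \<in> {1..<n}" for k
      using that f[OF that] by (auto simp: nth_append n_def)
    have last: "?Cs ! n = L" "?Cs ! ?f n = P" using i by (auto simp: nth_append n_def)
    have "?f k < k \<and> separator ?Cs k = ?Cs ! ?f k \<inter> ?Cs ! k" if "k \<in> {1..<length ?Cs}" for k
    proof (cases "k = n")
      case True
      have "separator ?Cs n = P \<inter> L"
        using separator_snoc[of Cs L] snoc.hyps(3,4) unfolding n_def by blast
      then show ?thesis using True last i by simp
    next
      case False
      then have k: "k \<in> {1..<n}" using that range by auto
      then show ?thesis
        using f[OF k] old[OF k] False by (simp add: separator_append n_def)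
    qed
    moreover have "E \<union> {(L, P), (P, L)} =
        (\<Union>k \<in> {1..<length ?Cs}. {(?Cs ! k, ?Cs ! ?f k), (?Cs ! ?f k, ?Cs ! k)})"
      unfolding range E using old last by (simp add: Un_commute)
    ultimately show ?case by blast
  qed
  then show ?thesis unfolding generated_from_def by auto
qed

text \<open>Each separator is the intersection of a clique with an earlier one, hence a clique
  contained in the earlier one.\<close>

lemma rip_perfect:
  assumes rip: "rip E Cs" and "set Cs = maximal_cliques G"
  shows "Cs \<in> perfect_sequences G"
proof -
  have "clique G (separator Cs k) \<and> (\<exists>k'<k. separator Cs k \<subseteq> Cs ! k')" if k: "k \<in> {1..<length Cs}" for k
  proof -
    obtain f where "f k < k" "separator Cs k = Cs ! f k \<inter> Cs ! k"
      using rip_generated[OF rip] k unfolding generated_from_def by metis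
    moreover have "clique G (Cs ! k)"
      using k assms(2) nth_mem[of k Cs] by (auto simp: maximal_cliques_def)
    ultimately show ?thesis by (auto simp: clique_def)
  qed
  then show ?thesis using assms rip_distinct[OF rip] by (auto simp: perfect_sequences_def)
qed

text \<open>The earlier clique that contains the separator serves as the point of attachment
  \<open>P\<close>, so each perfect sequence generates some tree.\<close>

lemma perfect_rip:
  assumes "distinct Cs" "\<And>k. k \<in> {1..<length Cs} \<Longrightarrow> \<exists>k'<k. separator Cs k \<subseteq> Cs ! k'" "Cs \<noteq> []"
  shows "\<exists>E. rip E Cs"
  using assms
proof (induction Cs rule: rev_induct)
  case (snoc L Cs)
  show ?case
  proof (cases "Cs = []")
    case True
    then show ?thesis using rip.single[of L] by auto
  next
    case False
    have "\<exists>k'<k. separator Cs k \<subseteq> Cs ! k'" if "k \<in> {1..<length Cs}" for k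
      using snoc.prems(2)[of k] that by (fastforce simp: separator_append nth_append)
    then obtain E where E: "rip E Cs" using snoc False by auto
    obtain k' where "k' < length Cs" "\<Union>(set Cs) \<inter> L \<subseteq> Cs ! k'"
      using snoc.prems(2)[of "length Cs"] False
      by (auto simp: separator_snoc nth_append Suc_le_eq split: if_splits)
    then show ?thesis using rip.snoc[OF E, of L "Cs ! k'"] snoc.prems(1) by auto
  qed
qed simp

section \<open>Walks and cycles as vertex lists\<close>

lemma awalk_with_proj:
  "pre_digraph.awalk (with_proj T) u p v \<longleftrightarrow> u \<in> pverts T \<and> set p \<subseteq> parcs T \<and> pcas u p v"
  by (simp add: pre_digraph.awalk_def cas_with_proj_eq)

lemma pawalk_verts_nonempty: "pawalk_verts u p \<noteq> []"
  by (cases p) auto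

lemma pcas_vwalk:
  "pcas u p v \<Longrightarrow> hd (pawalk_verts u p) = u \<and> last (pawalk_verts u p) = v
    \<and> vwalk_arcs (pawalk_verts u p) = p"
  by (induction p arbitrary: u) (auto simp: pawalk_verts_nonempty)

lemma vwalk_pcas:
  "xs \<noteq> [] \<Longrightarrow> pcas (hd xs) (vwalk_arcs xs) (last xs) \<and> pawalk_verts (hd xs) (vwalk_arcs xs) = xs"
  by (induction xs rule: vwalk_arcs.induct) auto

lemmas length_vwalk_arcs = vwalk_length_simp[unfolded vwalk_length_def]

lemma apath_vwalk:
  assumes "xs \<noteq> []" "distinct xs" "set (vwalk_arcs xs) \<subseteq> parcs T" "hd xs \<in> pverts T"
  shows "pre_digraph.apath (with_proj T) (hd xs) (vwalk_arcs xs) (last xs)"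
  using assms vwalk_pcas[of xs]
  by (simp add: pre_digraph.apath_def awalk_with_proj awalk_verts_with_proj_eq)

text \<open>Closing the list by its first vertex yields as many arcs as \<open>xs\<close> has
  vertices, so the bound 3 carries over.\<close>

lemma undirected_cycle_vwalk:
  assumes "distinct xs" "3 \<le> length xs" "set (vwalk_arcs (xs @ [hd xs])) \<subseteq> parcs T" "hd xs \<in> pverts T"
  shows "undirected_cycle T (vwalk_arcs (xs @ [hd xs]))"
proof -
  have "xs \<noteq> []" using assms by auto
  have len: "length (vwalk_arcs (xs @ [hd xs])) = length xs" by (simp add: length_vwalk_arcs)
  have "distinct (tl (xs @ [hd xs]))" using assms(1) \<open>xs \<noteq> []\<close> by (cases xs) auto
  then have "pre_digraph.cycle (with_proj T) (vwalk_arcs (xs @ [hd xs]))"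
    using assms vwalk_pcas[of "xs @ [hd xs]"] len \<open>xs \<noteq> []\<close>
    unfolding pre_digraph.cycle_def
    by (intro exI[of _ "hd xs"]) (auto simp: awalk_with_proj awalk_verts_with_proj_eq)
  then show ?thesis using assms len by (simp add: undirected_cycle_def)
qed

lemma undirected_cycleE:
  assumes "undirected_cycle T p"
  obtains xs where "distinct xs" "3 \<le> length xs" "p = vwalk_arcs (xs @ [hd xs])"
    "set p \<subseteq> parcs T"
proof -
  obtain u where u: "pcas u p u" "set p \<subseteq> parcs T" "distinct (tl (pawalk_verts u p))" "3 \<le> length p"
    using assms by (auto simp: undirected_cycle_def pre_digraph.cycle_def awalk_with_proj
        awalk_verts_with_proj_eq)
  define ys where "ys = pawalk_verts u p"
  have ys: "hd ys = u" "last ys = u" "vwalk_arcs ys = p" "ys \<noteq> []"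
    using pcas_vwalk[OF u(1)] pawalk_verts_nonempty by (auto simp: ys_def)
  have "length (pawalk_verts w q) = Suc (length q)" for w :: 'a and q
    by (induction q arbitrary: w) auto
  then have len: "length ys = Suc (length p)" by (simp add: ys_def)
  \<comment> \<open>The walk has one vertex more than arcs and its last vertex repeats
    \<open>u\<close>; dropping it leaves the distinct vertices of the cycle.\<close>
  then obtain xs where xs: "ys = xs @ [u]" using ys by (metis append_butlast_last_id)
  then have "xs \<noteq> []" using len u(4) by auto
  then obtain zs where zs: "xs = u # zs" using xs ys(1) by (cases xs) auto
  have "distinct xs" using u(3) xs zs unfolding ys_def[symmetric] by auto
  then show thesis using that[of xs] xs zs ys(3) len u(2,4) by auto
qed

text \<open>Connectedness is defined through the symmetric closure, which leaves symmetric arcs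
  unchanged; what remains is reachability along arcs.\<close>

lemma connected_with_proj:
  assumes wf: "pair_wf_digraph T" and sym: "sym (parcs T)"
  shows "connected (with_proj T) \<longleftrightarrow>
    pverts T \<noteq> {} \<and> (\<forall>u \<in> pverts T. \<forall>v \<in> pverts T. (u, v) \<in> (parcs T)\<^sup>*)"
proof -
  interpret pair_wf_digraph T by (rule wf)
  have "parcs (mk_symmetric (with_proj T)) = parcs T"
    using sym by (auto simp: parcs_mk_symmetric dest: symD)
  then have "(u \<rightarrow>\<^sup>*\<^bsub>with_proj (mk_symmetric (with_proj T))\<^esub> v) = (u \<rightarrow>\<^sup>*\<^bsub>with_proj T\<^esub> v)" for u v
    unfolding reachable_def by simp
  then show ?thesis
    unfolding connected_def strongly_connected_def by (simp add: reachable_conv)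
qed

lemma rip_clique_tree:
  assumes rip: "rip E Cs" and mc: "set Cs = maximal_cliques G"
  shows "\<lparr>pverts = set Cs, parcs = E\<rparr> \<in> clique_trees G"
proof -
  let ?T = "\<lparr>pverts = set Cs, parcs = E\<rparr>"
  have sub: "E \<subseteq> set Cs \<times> set Cs" by (rule rip_subset[OF rip])
  have graph: "pair_graph ?T"
  proof
    show "finite (parcs ?T)" using sub by (simp add: finite_subset)
    show "symmetric (with_proj ?T)" using rip_sym[OF rip] by (simp add: symmetric_def)
  qed (use sub rip_irrefl[OF rip] in auto)
  then interpret pair_graph ?T .
  have "(u, v) \<in> E\<^sup>*" if "u \<in> set Cs" "v \<in> set Cs" for u v
    using rip_rtrancl[OF rip that] .
  then have "connected (with_proj ?T)"
    using connected_with_proj[of ?T] rip_sym[OF rip] rip_nonempty[OF rip] pair_wf_digraph_axioms by simp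
  moreover have "\<not> undirected_cycle ?T p" for p
    using rip_acyclic[OF rip] by (auto elim!: undirected_cycleE)
  moreover have "C1 \<inter> C2 \<subseteq> C3"
    if p: "pre_digraph.apath (with_proj ?T) C1 p C2" and C3: "C3 \<in> set (pawalk_verts C1 p)" for C1 C2 C3 p
  proof -
    have p': "C1 \<in> set Cs" "set p \<subseteq> E" "pcas C1 p C2" "distinct (pawalk_verts C1 p)"
      using p by (simp_all add: pre_digraph.apath_def awalk_with_proj awalk_verts_with_proj_eq)
    note walk = pcas_vwalk[OF p'(3)]
    have "set (pawalk_verts C1 p) \<subseteq> set Cs"
      using p'(1,2)
    proof (induction p arbitrary: C1)
      case (Cons e p)
      then have "fst e \<in> set Cs" "snd e \<in> set Cs" using sub by auto
      then show ?case using Cons.IH[of "snd e"] Cons.prems by simp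
    qed simp
    then show ?thesis
      using rip_junction[OF rip pawalk_verts_nonempty p'(4) _ _ C3] walk p'(2) by simp
  qed
  ultimately show ?thesis
    using graph mc by (simp add: clique_trees_def undirected_tree_def)
qed

text \<open>Growing a clique tree leaf by leaf gives an order that generates it, so no tree is
  isolated in the bipartite graph.\<close>

lemma clique_tree_rip:
  assumes T: "T \<in> clique_trees G"
  shows "\<exists>Cs. set Cs = maximal_cliques G \<and> rip (parcs T) Cs"
proof -
  have tree: "pair_graph T" "connected (with_proj T)" "\<And>p. \<not> undirected_cycle T p"
    and mc: "pverts T = maximal_cliques G"
    and junction: "\<And>C1 C2 C3 p. pre_digraph.apath (with_proj T) C1 p C2 \<Longrightarrow> C3 \<in> set (pawalk_verts C1 p)
      \<Longrightarrow> C1 \<inter> C2 \<subseteq> C3"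
    using T unfolding clique_trees_def undirected_tree_def by blast+
  interpret pair_graph T by (rule tree(1))
  have sym: "sym (parcs T)" by (auto intro: symI arcs_symmetric)
  note conn = tree(2)[unfolded connected_with_proj[OF pair_wf_digraph_axioms sym]]
  then obtain r where r: "r \<in> pverts T" by auto
  have "\<exists>Cs. hd Cs = r \<and> set Cs = pverts T \<and> rip (parcs T) Cs"
  proof (rule rip_of_tree)
    show "\<not> set (vwalk_arcs (xs @ [hd xs])) \<subseteq> parcs T" if xs: "distinct xs" "3 \<le> length xs" for xs
    proof
      assume arcs: "set (vwalk_arcs (xs @ [hd xs])) \<subseteq> parcs T"
      moreover have "hd xs \<in> pverts T"
        using arcs xs(2) by (cases xs; cases "tl xs") (auto dest: in_arcsD1)
      ultimately show False using undirected_cycle_vwalk[OF xs] tree(3) by blast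
    qed
    show "hd xs \<inter> last xs \<subseteq> C" if xs: "xs \<noteq> []" "distinct xs" "set xs \<subseteq> pverts T"
      "set (vwalk_arcs xs) \<subseteq> parcs T" "C \<in> set xs" for xs C
    proof -
      have "hd xs \<in> pverts T" using xs(1,3) by auto
      then show ?thesis
        using junction[OF apath_vwalk[OF xs(1,2,4)], of C] vwalk_pcas[OF xs(1)] xs(5) by simp
    qed
  qed (use r conn sym no_loops' pair_finite_verts in \<open>auto dest: in_arcsD1 in_arcsD2\<close>)
  then show ?thesis using mc by auto
qed

section \<open>Chordal graphs have simplicial vertices\<close>

lemma split_list_two:
  assumes "u \<in> set xs" "v \<in> set xs" "u \<noteq> v"
  obtains a b c where "xs = a @ u # b @ v # c" | a b c where "xs = a @ v # b @ u # c"
proof -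
  obtain a b where ab: "xs = a @ u # b" using assms(1) by (meson split_list)
  then consider "v \<in> set a" | "v \<in> set b" using assms by auto
  then show thesis
  proof cases
    case 1
    then obtain c d where "a = c @ v # d" by (meson split_list)
    then show ?thesis using ab that(2)[of c d b] by simp
  next
    case 2
    then obtain c d where "b = c @ v # d" by (meson split_list)
    then show ?thesis using ab that(1)[of a c d] by simp
  qed
qed

lemma rtrancl_vwalk:
  assumes "(s, t) \<in> (E \<inter> W \<times> W)\<^sup>*" "s \<in> W"
  shows "\<exists>xs. xs \<noteq> [] \<and> hd xs = s \<and> last xs = t \<and> set xs \<subseteq> W \<and> set (vwalk_arcs xs) \<subseteq> E"
  using assms(1)
proof (induction rule: rtrancl_induct)
  case base
  show ?case using assms(2) by (intro exI[of _ "[s]"]) auto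
next
  case (step y z)
  then obtain xs where "xs \<noteq> []" "hd xs = s" "last xs = y" "set xs \<subseteq> W" "set (vwalk_arcs xs) \<subseteq> E"
    by blast
  then show ?case using step.hyps by (intro exI[of _ "xs @ [z]"]) (auto simp: vwalk_arcs_append)
qed

text \<open>A shortest walk is an induced path: a repeated vertex or an arc between non-consecutive
  vertices would give a shortcut.\<close>

lemma shortest_vwalk:
  assumes "(s, t) \<in> (E \<inter> W \<times> W)\<^sup>*" "s \<in> W" "sym E"
  obtains xs where "xs \<noteq> []" "hd xs = s" "last xs = t" "set xs \<subseteq> W" "set (vwalk_arcs xs) \<subseteq> E"
    "distinct xs" "\<And>u v. u \<in> set xs \<Longrightarrow> v \<in> set xs \<Longrightarrow> u \<noteq> v \<Longrightarrow> (u, v) \<in> E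
      \<Longrightarrow> (u, v) \<in> set (vwalk_arcs xs) \<or> (v, u) \<in> set (vwalk_arcs xs)"
proof -
  let ?P = "\<lambda>xs. xs \<noteq> [] \<and> hd xs = s \<and> last xs = t \<and> set xs \<subseteq> W \<and> set (vwalk_arcs xs) \<subseteq> E"
  obtain xs where P: "?P xs" and min: "\<And>ys. ?P ys \<Longrightarrow> length xs \<le> length ys"
    using rtrancl_vwalk[OF assms(1,2)] ex_has_least_nat[of ?P _ length] by metis
  have dist: "distinct xs"
  proof (rule ccontr)
    assume "\<not> distinct xs"
    then obtain a b c x where xs: "xs = a @ [x] @ b @ [x] @ c" using not_distinct_decomp by blast
    have "?P (a @ x # c)"
      using P unfolding xs
      by (cases "a = []"; cases "b = []"; cases "c = []") (auto simp: vwalk_arcs_append)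
    from min[OF this] show False by (simp add: xs)
  qed
  \<comment> \<open>Shown for \<open>u\<close> before \<open>v\<close>; the other order follows by
    symmetry of \<open>E\<close>.\<close>
  have chord: "(u, v) \<in> set (vwalk_arcs xs)" if xs: "xs = a @ u # b @ v # c" and uv: "(u, v) \<in> E" for a b c u v
  proof (cases "b = []")
    case True
    then show ?thesis by (cases "a = []") (auto simp: xs vwalk_arcs_append)
  next
    case False
    have "?P (a @ u # v # c)"
      using P uv False unfolding xs
      by (cases "a = []"; cases "c = []") (auto simp: vwalk_arcs_append)
    from min[OF this] False show ?thesis by (simp add: xs)
  qed
  show thesis
  proof
    show "(u, v) \<in> set (vwalk_arcs xs) \<or> (v, u) \<in> set (vwalk_arcs xs)"
      if "u \<in> set xs" "v \<in> set xs" "u \<noteq> v" "(u, v) \<in> E" for u v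
      using that(1-3)
    proof (cases rule: split_list_two)
      case (1 a b c)
      then show ?thesis using chord that(4) by blast
    next
      case (2 a b c)
      then show ?thesis using chord symD[OF assms(3) that(4)] by blast
    qed
  qed (use P dist in auto)
qed

text \<open>If \<open>s\<close> and \<open>t\<close> were not adjacent, a shortest path between them
  in \<open>W\<close> would have at least three vertices. Closed through \<open>r\<close> it becomes
  a cycle of length at least 4 without a chord, as the path is induced and \<open>r\<close> sees
  only its ends.\<close>

lemma chordal_neighbours_adjacent:
  assumes G: "pair_graph G" and "chordal G"
    and st: "(s, t) \<in> (parcs G \<inter> W \<times> W)\<^sup>*" "s \<in> W" "s \<noteq> t"
    and r: "r \<notin> W" "(r, s) \<in> parcs G" "(t, r) \<in> parcs G"
    and other: "\<And>h. h \<in> W \<Longrightarrow> h \<noteq> s \<Longrightarrow> h \<noteq> t \<Longrightarrow> (r, h) \<notin> parcs G"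
  shows "(s, t) \<in> parcs G"
proof (rule ccontr)
  assume nst: "(s, t) \<notin> parcs G"
  interpret pair_graph G by (rule G)
  have sym: "sym (parcs G)" by (auto intro: symI arcs_symmetric)
  obtain xs where xs: "xs \<noteq> []" "hd xs = s" "last xs = t" "set xs \<subseteq> W" "set (vwalk_arcs xs) \<subseteq> parcs G"
    "distinct xs" and chordless: "\<And>u v. u \<in> set xs \<Longrightarrow> v \<in> set xs \<Longrightarrow> u \<noteq> v \<Longrightarrow> (u, v) \<in> parcs G
      \<Longrightarrow> (u, v) \<in> set (vwalk_arcs xs) \<or> (v, u) \<in> set (vwalk_arcs xs)"
    using shortest_vwalk[OF st(1,2) sym] by blast
  have len: "3 \<le> length xs"
  proof (rule ccontr)
    assume "\<not> 3 \<le> length xs"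
    then have "xs = [s] \<or> xs = [s, t]"
      using xs(1-3) by (cases xs; cases "tl xs"; cases "tl (tl xs)") auto
    then show False
    proof
      assume "xs = [s]"
      then show False using xs(3) st(3) by simp
    next
      assume "xs = [s, t]"
      then show False using xs(5) nst by simp
    qed
  qed
  let ?p = "vwalk_arcs ((r # xs) @ [hd (r # xs)])"
  have p: "set ?p = {(r, s), (t, r)} \<union> set (vwalk_arcs xs)"
    using xs(1-3) by (auto simp: vwalk_arcs_append)
  have "r \<notin> set xs" using r(1) xs(4) by blast
  then have "undirected_cycle G ?p"
    using xs(5,6) len p r by (intro undirected_cycle_vwalk) (auto dest: in_arcsD1)
  moreover have "4 \<le> length ?p"
    using len by (simp add: length_vwalk_arcs)
  ultimately obtain u v where uv: "u \<in> fst ` set ?p" "v \<in> fst ` set ?p" "(u, v) \<in> parcs G"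
    "(u, v) \<notin> set ?p" "(v, u) \<notin> set ?p"
    using \<open>chordal G\<close> unfolding chordal_def by blast
  have "t \<in> set xs" using xs(1,3) last_in_set by blast
  then have verts: "w \<in> insert r (set xs)" if "w \<in> fst ` set ?p" for w
    using that unfolding p by (auto dest: vwalk_arcs_in_set)
  have "u \<noteq> v" using uv(3) no_loops' by blast
  \<comment> \<open>The arcs between \<open>r\<close> and the path go to its two ends only, and
    these are edges of the cycle, not chords.\<close>
  have end_r: "h = s \<or> h = t" if "(r, h) \<in> parcs G" "h \<in> set xs" for h
    using other[of h] that xs(4) by blast
  from verts[OF uv(1)] verts[OF uv(2)] \<open>u \<noteq> v\<close>
  consider "u = r" "v \<in> set xs" | "v = r" "u \<in> set xs" | "u \<in> set xs" "v \<in> set xs" by blast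
  then show False
  proof cases
    case 1
    then show ?thesis using end_r[of v] uv(3-5) p by auto
  next
    case 2
    then show ?thesis using end_r[of u] uv(3-5) p arcs_symmetric by blast
  next
    case 3
    then show ?thesis using chordless[of u v] uv(3-5) p \<open>u \<noteq> v\<close> by blast
  qed
qed

text \<open>Let H be a maximal connected subset of W that does not dominate W, S its neighbourhood and R the
  rest.  By maximality S is completely joined to R, so a nonadjacent pair in S, a shortest path through
  H and a vertex of R would form a chordless cycle.  Hence S is a clique, and a simplicial vertex
  of R is simplicial in W.\<close>

lemma simplicial_vertex:
  assumes G: "pair_graph G" and "chordal G" and "finite W" "W \<noteq> {}" "W \<subseteq> pverts G"
  shows "\<exists>v\<in>W. clique G {u \<in> W. (v, u) \<in> parcs G}"
  using assms(3-5)
proof (induction W rule: finite_psubset_induct)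
  case (psubset W)
  interpret pair_graph G by (rule G)
  define E where "E = parcs G"
  have sym: "(b, a) \<in> E" if "(a, b) \<in> E" for a b using that arcs_symmetric by (simp add: E_def)
  show ?case
  proof (cases "clique G W")
    case True
    then show ?thesis using psubset.prems by (fastforce simp: clique_def)
  next
    case False
    then obtain a b where ab: "a \<in> W" "b \<in> W" "a \<noteq> b" "(a, b) \<notin> E"
      using psubset.prems by (auto simp: clique_def E_def)
    define N where "N H = {w \<in> W - H. \<exists>h\<in>H. (h, w) \<in> E}" for H
    define HH where "HH = {H. H \<subseteq> W \<and> H \<noteq> {} \<and> (\<forall>x\<in>H. \<forall>y\<in>H. (x, y) \<in> (E \<inter> H \<times> H)\<^sup>*) \<and> W - H - N H \<noteq> {}}"
    have "finite HH" using psubset.hyps(1) by (auto simp: HH_def intro: finite_subset[of _ "Pow W"])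
    \<comment> \<open>The vertex \<open>b\<close> witnesses that \<open>{a}\<close> does not
      dominate \<open>W\<close>.\<close>
    moreover have "{a} \<in> HH" using ab by (auto simp: HH_def N_def)
    ultimately obtain H where H: "H \<in> HH" and max: "\<And>K. K \<in> HH \<Longrightarrow> H \<subseteq> K \<Longrightarrow> K = H"
      using finite_has_maximal[of HH] by (metis empty_iff)
    define S R where "S = N H" and "R = W - H - N H"
    have HW: "H \<subseteq> W" "H \<noteq> {}" "R \<noteq> {}" and connH: "\<And>x y. x \<in> H \<Longrightarrow> y \<in> H \<Longrightarrow> (x, y) \<in> (E \<inter> H \<times> H)\<^sup>*"
      using H by (auto simp: HH_def R_def)
    have HR: "(h, r) \<notin> E" if "h \<in> H" "r \<in> R" for h r
      using that by (auto simp: R_def N_def)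
    have ext: "(h, s) \<in> (E \<inter> K \<times> K)\<^sup>* \<and> (s, h) \<in> (E \<inter> K \<times> K)\<^sup>*"
      if s: "s \<in> S" and "h \<in> H" "insert s H \<subseteq> K" for s h K
    proof -
      obtain g where g: "g \<in> H" "(g, s) \<in> E" using s by (auto simp: S_def N_def)
      have mono: "(E \<inter> H \<times> H)\<^sup>* \<subseteq> (E \<inter> K \<times> K)\<^sup>*" using that(3) by (intro rtrancl_mono) auto
      have "(h, g) \<in> (E \<inter> K \<times> K)\<^sup>*" "(g, h) \<in> (E \<inter> K \<times> K)\<^sup>*"
        using connH that(2) g(1) mono by blast+
      moreover have "(g, s) \<in> E \<inter> K \<times> K" "(s, g) \<in> E \<inter> K \<times> K" using g that(3) sym by auto
      ultimately show ?thesis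
        by (meson converse_rtrancl_into_rtrancl rtrancl_into_rtrancl)
    qed
    have SR: "(s, r) \<in> E" if s: "s \<in> S" and r: "r \<in> R" for s r
    proof (rule ccontr)
      assume nsr: "(s, r) \<notin> E"
      \<comment> \<open>Adding \<open>s\<close> keeps the set connected and leaves \<open>r\<close>
        undominated, against the maximality of \<open>H\<close>.\<close>
      let ?K = "insert s H"
      have sW: "s \<in> W" "s \<notin> H" using s by (auto simp: S_def N_def)
      have "r \<in> W" "r \<notin> H" "r \<noteq> s" using r s by (auto simp: R_def S_def)
      moreover have "r \<notin> N ?K" using HR[OF _ r] nsr by (simp add: N_def)
      ultimately have "r \<in> W - ?K - N ?K" by blast
      moreover have "(x, y) \<in> (E \<inter> ?K \<times> ?K)\<^sup>*" if "x \<in> ?K" "y \<in> ?K" for x y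
      proof -
        have "(E \<inter> H \<times> H)\<^sup>* \<subseteq> (E \<inter> ?K \<times> ?K)\<^sup>*" by (intro rtrancl_mono) auto
        then show ?thesis using that connH[of x y] ext[OF s, of x ?K] ext[OF s, of y ?K] by blast
      qed
      ultimately have "?K \<in> HH" using HW sW by (auto simp: HH_def)
      from max[OF this] sW show False by blast
    qed
    have SS: "(s, t) \<in> E" if "s \<in> S" "t \<in> S" "s \<noteq> t" for s t
    proof -
      obtain r where r: "r \<in> R" using HW by blast
      obtain h where h: "h \<in> H" using HW by blast
      \<comment> \<open>Apart from \<open>s\<close> and \<open>t\<close> the path is confined to
        \<open>H\<close>, where \<open>r\<close> has no neighbour.\<close>
      let ?W = "H \<union> {s, t}"
      have "(s, h) \<in> (E \<inter> ?W \<times> ?W)\<^sup>*" "(h, t) \<in> (E \<inter> ?W \<times> ?W)\<^sup>*"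
        using ext[OF that(1) h, of ?W] ext[OF that(2) h, of ?W] by blast+
      then have "(s, t) \<in> (parcs G \<inter> ?W \<times> ?W)\<^sup>*" unfolding E_def by (rule rtrancl_trans)
      moreover have "r \<notin> ?W" using r that by (auto simp: R_def S_def)
      moreover have "(r, s) \<in> E" "(t, r) \<in> E" using SR r that sym by blast+
      ultimately show ?thesis
        using chordal_neighbours_adjacent[OF G \<open>chordal G\<close>, of s t ?W r] that(3) HR r sym
        unfolding E_def by blast
    qed
    have "R \<subset> W" using HW by (auto simp: R_def)
    then obtain v where v: "v \<in> R" "clique G {u \<in> R. (v, u) \<in> parcs G}"
      using psubset.IH[of R] HW psubset.prems by blast
    \<comment> \<open>No neighbour of \<open>v\<close> lies in \<open>H\<close>, because
      \<open>v\<close> is in \<open>R\<close>.\<close>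
    have nbrs: "{u \<in> W. (v, u) \<in> E} \<subseteq> {u \<in> R. (v, u) \<in> E} \<union> S"
      using HR[OF _ v(1)] sym by (auto simp: R_def S_def)
    have "(x, y) \<in> E"
      if xy: "x \<in> {u \<in> R. (v, u) \<in> E} \<union> S" "y \<in> {u \<in> R. (v, u) \<in> E} \<union> S" "x \<noteq> y" for x y
    proof (cases "x \<in> S"; cases "y \<in> S")
      assume "x \<notin> S" "y \<notin> S"
      then show ?thesis using xy v(2) by (auto simp: clique_def E_def)
    qed (use xy SS[of x y] SR[of x y] SR[of y x] sym[of y x] in auto)
    then have "(x, y) \<in> E" if "x \<in> {u \<in> W. (v, u) \<in> E}" "y \<in> {u \<in> W. (v, u) \<in> E}" "x \<noteq> y" for x y
      using that nbrs by (meson subsetD)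
    moreover have "{u \<in> W. (v, u) \<in> E} \<subseteq> pverts G" using psubset.prems(2) by blast
    ultimately have "clique G {u \<in> W. (v, u) \<in> E}"
      unfolding clique_def E_def[symmetric] by blast
    then show ?thesis using v(1) \<open>R \<subset> W\<close> unfolding E_def by blast
  qed
qed

section \<open>Running intersection orders of chordal graphs\<close>

definition maximal_cliques_in :: "'a pair_pre_digraph \<Rightarrow> 'a set \<Rightarrow> 'a set set" where
  "maximal_cliques_in G W =
     {C. C \<subseteq> W \<and> clique G C \<and> (\<forall>D. D \<subseteq> W \<and> clique G D \<and> C \<subseteq> D \<longrightarrow> D = C)}"

lemma maximal_cliques_in_pverts: "maximal_cliques_in G (pverts G) = maximal_cliques G"
  by (auto simp: maximal_cliques_in_def maximal_cliques_def clique_def)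

lemma clique_extend:
  assumes "finite W" "D \<subseteq> W" "clique G D"
  shows "\<exists>M\<in>maximal_cliques_in G W. D \<subseteq> M"
proof -
  let ?A = "{C. C \<subseteq> W \<and> clique G C}"
  have "finite ?A" "D \<in> ?A" using assms by auto
  from finite_has_maximal2[OF this] obtain M where M: "M \<in> ?A" "D \<subseteq> M" "\<forall>C\<in>?A. M \<subseteq> C \<longrightarrow> M = C"
    by blast
  then have "M \<in> maximal_cliques_in G W" unfolding maximal_cliques_in_def by blast
  then show ?thesis using M(2) by blast
qed

text \<open>Only \<open>N\<close> can receive the new element \<open>v\<close>, so intersections of
  distinct members do not change and every attachment stays valid.\<close>

lemma rip_insert_new:
  assumes "rip E Cs" "v \<notin> \<Union>(set Cs)"
  shows "\<exists>E'. rip E' (map (\<lambda>C. if C = N then insert v N else C) Cs)"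
  using assms
proof (induction rule: rip.induct)
  case (single C)
  then show ?case by (auto intro: rip.single)
next
  case (snoc E Cs L P)
  define g where "g = (\<lambda>C. if C = N then insert v N else C)"
  obtain E' where E': "rip E' (map g Cs)" using snoc by (auto simp: g_def)
  have g: "x \<in> g C \<longleftrightarrow> x \<in> C \<or> x = v \<and> C = N" for x C by (auto simp: g_def)
  have new: "v \<notin> C" if "C \<in> set (Cs @ [L])" for C using that snoc.prems by auto
  have vL: "v \<notin> g C \<or> v \<notin> g L" if "C \<in> set Cs" for C
    using that new[of C] new[of L] snoc.hyps(2) by (auto simp: g)
  have "g L \<noteq> g C" if C: "C \<in> set Cs" for C
  proof
    assume eq: "g L = g C"
    then have "v \<notin> g C" "v \<notin> g L" using vL[OF C] by auto
    then have "C \<noteq> N" "L \<noteq> N" by (auto simp: g)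
    then show False using eq C snoc.hyps(2) by (auto simp: g_def)
  qed
  then have "g L \<notin> set (map g Cs)" by auto
  moreover have "\<Union>(set (map g Cs)) \<inter> g L \<subseteq> g P"
  proof
    fix x assume "x \<in> \<Union>(set (map g Cs)) \<inter> g L"
    then obtain C where C: "C \<in> set Cs" "x \<in> g C" "x \<in> g L" by auto
    then have "x \<noteq> v" using vL by blast
    then have "x \<in> C" "x \<in> L" using C by (auto simp: g)
    then show "x \<in> g P" using snoc.hyps(4) C(1) by (auto simp: g)
  qed
  ultimately have "rip (E' \<union> {(g L, g P), (g P, g L)}) (map g (Cs @ [L]))"
    using rip.snoc[OF E', of "g L" "g P"] snoc.hyps(3) by simp
  then show ?case unfolding g_def by blast
qed

text \<open>A simplicial vertex \<open>v\<close> is removed; \<open>W\<close> shrinks while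
  \<open>G\<close> stays fixed. The closed neighbourhood \<open>?L\<close> of \<open>v\<close> in
  \<open>W\<close> is the only maximal clique containing \<open>v\<close>. It replaces the
  neighbourhood \<open>N\<close> if that was maximal without \<open>v\<close>; otherwise it is a new
  leaf on a maximal clique containing \<open>N\<close>.\<close>

lemma chordal_rip:
  assumes G: "pair_graph G" and "chordal G" and "finite W" "W \<subseteq> pverts G"
  shows "\<exists>E Cs. set Cs = maximal_cliques_in G W \<and> rip E Cs"
  using assms(3,4)
proof (induction W rule: finite_psubset_induct)
  case (psubset W)
  interpret pair_graph G by (rule G)
  show ?case
  proof (cases "W = {}")
    case True
    \<comment> \<open>Without vertices the empty set is the one maximal clique, so the order still
      has one member.\<close>
    then have "maximal_cliques_in G W = {{}}" by (auto simp: maximal_cliques_in_def clique_def)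
    then show ?thesis using rip.single[of "{}"] by (metis list.set(1,2))
  next
    case False
    then obtain v where v: "v \<in> W" "clique G {u \<in> W. (v, u) \<in> parcs G}"
      using simplicial_vertex[OF G \<open>chordal G\<close> psubset.hyps(1) False psubset.prems] by blast
    define N where "N = {u \<in> W. (v, u) \<in> parcs G}"
    let ?W = "W - {v}" and ?L = "insert v N"
    have N: "N \<subseteq> ?W" "clique G N" using v no_loops' by (auto simp: N_def)
    have "(v, u) \<in> parcs G \<and> (u, v) \<in> parcs G" if "u \<in> N" for u
      using that arcs_symmetric by (simp add: N_def)
    then have L: "clique G ?L" "?L \<subseteq> W"
      using v(1) N psubset.prems by (auto simp: clique_def)
    have in_L: "D \<subseteq> ?L" if "D \<subseteq> W" "clique G D" "v \<in> D" for D
      using that by (auto simp: N_def clique_def)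
    have "?W \<subset> W" using v by auto
    then obtain E Cs where Cs: "set Cs = maximal_cliques_in G ?W" and rip: "rip E Cs"
      using psubset.IH[of ?W] psubset.prems by blast
    have old: "C \<subseteq> ?W" if "C \<in> maximal_cliques_in G ?W" for C
      using that by (simp add: maximal_cliques_in_def)
    then have vCs: "v \<notin> \<Union>(set Cs)" using Cs by auto
    \<comment> \<open>Only \<open>N\<close> can stop being maximal: a clique maximal without
      \<open>v\<close> can be enlarged only by \<open>v\<close>, then lies in \<open>N\<close>, and
      so equals \<open>N\<close>.\<close>
    have "maximal_cliques_in G W = insert ?L (maximal_cliques_in G ?W - {N})"
    proof (intro set_eqI iffI)
      fix C assume C: "C \<in> maximal_cliques_in G W"
      then have CW: "C \<subseteq> W" "clique G C" and max: "\<And>D. D \<subseteq> W \<Longrightarrow> clique G D \<Longrightarrow> C \<subseteq> D \<Longrightarrow> D = C"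
        by (auto simp: maximal_cliques_in_def)
      show "C \<in> insert ?L (maximal_cliques_in G ?W - {N})"
      proof (cases "v \<in> C")
        case True
        then show ?thesis using max[OF L(2,1)] in_L[OF CW True] by blast
      next
        case False
        then have "C \<noteq> N" using max[OF L(2,1)] by blast
        moreover have "C \<in> maximal_cliques_in G ?W"
          using CW max False unfolding maximal_cliques_in_def by blast
        ultimately show ?thesis by blast
      qed
    next
      fix C assume C: "C \<in> insert ?L (maximal_cliques_in G ?W - {N})"
      show "C \<in> maximal_cliques_in G W"
      proof (cases "C = ?L")
        case True
        then show ?thesis using L in_L unfolding maximal_cliques_in_def by blast
      next
        case False
        then have CW: "C \<subseteq> ?W" "clique G C" "C \<noteq> N"
          and max: "\<And>D. D \<subseteq> ?W \<Longrightarrow> clique G D \<Longrightarrow> C \<subseteq> D \<Longrightarrow> D = C"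
          using C by (auto simp: maximal_cliques_in_def)
        have "D = C" if D: "D \<subseteq> W" "clique G D" "C \<subseteq> D" for D
        proof (cases "v \<in> D")
          case True
          then have "C \<subseteq> N" using in_L[OF D(1,2)] D(3) CW(1) by blast
          then show ?thesis using max[OF N] CW(3) by blast
        next
          case False
          then show ?thesis using max[of D] D by blast
        qed
        then show ?thesis using CW unfolding maximal_cliques_in_def by blast
      qed
    qed
    note mc = this
    show ?thesis
    proof (cases "N \<in> maximal_cliques_in G ?W")
      case True
      let ?g = "\<lambda>C. if C = N then ?L else C"
      obtain E' where "rip E' (map ?g Cs)" using rip_insert_new[OF rip vCs] by blast
      moreover have "set (map ?g Cs) = maximal_cliques_in G W"
        using True unfolding mc Cs[symmetric] by auto
      ultimately show ?thesis by blast
    next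
      case False
      obtain M where M: "M \<in> set Cs" "N \<subseteq> M"
        using clique_extend[of ?W N G] N psubset.hyps(1) Cs by auto
      \<comment> \<open>The members of \<open>Cs\<close> avoid \<open>v\<close>, so they meet
        \<open>?L\<close> inside \<open>N\<close> and hence inside \<open>M\<close>.\<close>
      have "rip (E \<union> {(?L, M), (M, ?L)}) (Cs @ [?L])"
        using vCs M by (intro rip.snoc[OF rip]) auto
      moreover have "set (Cs @ [?L]) = maximal_cliques_in G W" using False mc Cs by auto
      ultimately show ?thesis by blast
    qed
  qed
qed

section \<open>The bipartite graph\<close>

theorem theorem4p1:
  fixes G :: "'v pair_pre_digraph"
  assumes "pair_graph G"
    and "connected (with_proj G)"
    and "chordal G"
  shows "connected (with_proj
           (bipartite_graph (clique_trees G) (perfect_sequences G) (generation_rel G)))"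
proof -
  let ?B = "bipartite_graph (clique_trees G) (perfect_sequences G) (generation_rel G)"
  interpret pair_graph G by (rule assms(1))
  have rel: "(Inr Cs, Inl \<lparr>pverts = set Cs, parcs = E\<rparr>) \<in> parcs ?B"
    "(Inl \<lparr>pverts = set Cs, parcs = E\<rparr>, Inr Cs) \<in> parcs ?B"
    if "rip E Cs" "set Cs = maximal_cliques G" for E Cs
    using rip_clique_tree[OF that] rip_perfect[OF that] rip_generated[OF that(1)]
    by (force simp: bipartite_graph_def generation_rel_def)+
  have share_step: "(Inr Cs, Inr Ds) \<in> (parcs ?B)\<^sup>*"
    if share: "(Cs, Ds) \<in> share" and mc: "set Cs = maximal_cliques G" for Cs Ds
  proof -
    obtain E where E: "set Cs = set Ds" "rip E Cs" "rip E Ds" using share by (auto simp: share_def)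
    then show ?thesis using rel(1)[OF E(2)] rel(2)[OF E(3)] mc
      by (metis (no_types) r_into_rtrancl rtrancl_into_rtrancl)
  qed
  have shares: "set Ds = maximal_cliques G \<and> (Inr Cs, Inr Ds) \<in> (parcs ?B)\<^sup>*"
    if "(Cs, Ds) \<in> share\<^sup>*" "set Cs = maximal_cliques G" for Cs Ds
    using that
  proof (induction rule: rtrancl_induct)
    case (step Ds Es)
    then have "set Es = maximal_cliques G" by (auto simp: share_def)
    then show ?case using step share_step by (meson rtrancl_trans)
  qed simp
  obtain E0 Cs0 where Cs0: "set Cs0 = maximal_cliques G" "rip E0 Cs0"
    using chordal_rip[OF assms(1,3) pair_finite_verts subset_refl] by (auto simp: maximal_cliques_in_pverts)
  have sym: "sym (parcs ?B)" by (auto simp: bipartite_graph_def intro!: symI)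
  \<comment> \<open>The fixed sequence \<open>Cs0\<close>, which exists by chordality, reaches every
    tree and every sequence; symmetry then joins any two vertices.\<close>
  have from0: "(Inr Cs0, x) \<in> (parcs ?B)\<^sup>*" if "x \<in> pverts ?B" for x
  proof -
    have to_seq: "(Inr Cs0, Inr Cs) \<in> (parcs ?B)\<^sup>*" if "set Cs = maximal_cliques G" "rip E Cs" for Cs E
      using shares[OF share_connected[OF Cs0(2) that(2)]] Cs0(1) that(1) by simp
    from that consider (tree) T where "x = Inl T" "T \<in> clique_trees G"
      | (seq) Cs where "x = Inr Cs" "Cs \<in> perfect_sequences G"
      by (auto simp: bipartite_graph_def)
    then show ?thesis
    proof cases
      case tree
      then obtain Cs where Cs: "set Cs = maximal_cliques G" "rip (parcs T) Cs"
        using clique_tree_rip by blast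
      \<comment> \<open>Writing \<open>T\<close> as a record brings it into the form that
        \<open>rel\<close> speaks of.\<close>
      have "T = \<lparr>pverts = set Cs, parcs = parcs T\<rparr>"
        using tree(2) Cs(1) by (simp add: clique_trees_def)
      then show ?thesis using to_seq[OF Cs] rel(1)[OF Cs(2,1)] tree(1)
        by (metis rtrancl_into_rtrancl)
    next
      case seq
      \<comment> \<open>There is thus at least one maximal clique, so \<open>Cs\<close> cannot be
        the empty list.\<close>
      moreover have "Cs0 \<noteq> []" using rip_nonempty[OF Cs0(2)] .
      ultimately have "distinct Cs" "set Cs = maximal_cliques G" "Cs \<noteq> []"
        "\<And>k. k \<in> {1..<length Cs} \<Longrightarrow> \<exists>k'<k. separator Cs k \<subseteq> Cs ! k'"
        using Cs0(1) by (auto simp: perfect_sequences_def)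
      then show ?thesis using perfect_rip[of Cs] to_seq seq(1) by blast
    qed
  qed
  have "(x, y) \<in> (parcs ?B)\<^sup>*" if "x \<in> pverts ?B" "y \<in> pverts ?B" for x y
    using from0[OF that(1)] from0[OF that(2)] sym_rtrancl[OF sym] by (meson rtrancl_trans symD)
  moreover have "Inr Cs0 \<in> pverts ?B"
    using rip_perfect[OF Cs0(2,1)] by (simp add: bipartite_graph_def)
  moreover have "pair_wf_digraph ?B"
    by unfold_locales (auto simp: bipartite_graph_def generation_rel_def)
  ultimately show ?thesis using connected_with_proj[OF _ sym] by blast
qed

end
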